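(* Let $\Gamma=(V,E)$ be a finite, undirected, weighted, connected graph with $N\ge 2$ vertices (loops allowed), let $l\ge1$ be an integer, and let $h[l]$ be the Cheeger constant of the neighborhood graph $\Gamma[l]$. The eigenvalues $0=\lambda_0<\lambda_1\le\dots\le\lambda_{N-1}$ of the normalized Laplace operator $\Delta$ of $\Gamma$ satisfy $$1-\left(1-h^2[l]\right)^{\frac{1}{2l}}\le\lambda_1\le\dots\le\lambda_{N-1}\le1+\left(1-h^2[l]\right)^{\frac1{2l}}\quad\text{if }l\text{ is even},$$ and $$1-\left(1-h^2[l]\right)^{\frac{1}{2l}}\le\lambda_1\quad\text{if }l\text{ is odd}.$$
   Context: The weight function $w:V\times V\to\mathbb{R}$ satisfies $w_{ij}=w_{ji}$, $w_{ij}>0$ if $i\sim j$ (i.e. $i,j$ are joined by an edge; $i=j$ allowed, a loop) and $w_{ij}=0$ otherwise. The degree is $d_i=\sum_{j}w_{ij}$, and $\Delta v(i)=\frac{1}{d_i}\sum_j w_{ij}(v(i)-v(j))$ for $v:V\to\mathbb{R}$. The neighborhood graph $\Gamma[l]$ is the weighted graph on the same vertex set $V$ with weights $w_{ij}[1]=w_{ij}$ and, for $l>1$, $$w_{ij}[l]=\sum_{k_1,\dots,k_{l-1}\in V}\frac{1}{d_{k_1}}\cdots\frac{1}{d_{k_{l-1}}}w_{ik_1}w_{k_1k_2}\cdots w_{k_{l-1}j},$$ and degrees $d_i[l]=\sum_jw_{ij}[l]$ (which equal $d_i$). Its Cheeger constant is $$h[l]=\min_{U}\frac{\sum_{k\in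 U,\,m\in V\setminus U}w_{km}[l]}{\min\{\sum_{i\in U}d_i[l],\ \sum_{i\in V\setminus U}d_i[l]\}},$$ the minimum over $U\subset V$ with $U$ and $V\setminus U$ nonempty; one has $0\le h[l]\le 1$. Here $h^2[l]=(h[l])^2$ and roots are nonnegative roots. *)

theory Defs
  imports "HOL-Analysis.Analysis" "HOL-Library.Multiset"
begin

text \<open>The vertex set is the finite type \<open>'v\<close>; an edge \<open>{i, j}\<close> is represented by both ordered pairs
  \<open>(i, j)\<close> and \<open>(j, i)\<close>, and \<open>(i, i)\<close> is a loop.\<close>

definition weighted_graph :: "('v \<times> 'v) set \<Rightarrow> ('v \<Rightarrow> 'v \<Rightarrow> real) \<Rightarrow> bool" where
  "weighted_graph E w \<longleftrightarrow> sym E \<and> (\<forall>i j. w i j = w j i) \<and>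
     (\<forall>i j. (i, j) \<in> E \<longrightarrow> w i j > 0) \<and> (\<forall>i j. (i, j) \<notin> E \<longrightarrow> w i j = 0)"

definition connected_graph :: "('v \<times> 'v) set \<Rightarrow> bool" where
  "connected_graph E \<longleftrightarrow> (\<forall>i j. (i, j) \<in> E\<^sup>*)"

definition degree :: "('v::finite \<Rightarrow> 'v \<Rightarrow> real) \<Rightarrow> 'v \<Rightarrow> real" where
  "degree w i = (\<Sum>j\<in>UNIV. w i j)"

definition laplacian :: "('v::finite \<Rightarrow> 'v \<Rightarrow> real) \<Rightarrow> real ^ 'v \<Rightarrow> real ^ 'v" where
  "laplacian w v = (\<chi> i. 1 / degree w i * (\<Sum>j\<in>UNIV. w i j * (v $ i - v $ j)))"

definition eigenspace :: "(real ^ 'v \<Rightarrow> real ^ 'v) \<Rightarrow> real \<Rightarrow> (real ^ 'v::finite) set" where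
  "eigenspace f \<mu> = {v. f v = \<mu> *\<^sub>R v}"

definition eigenvalue :: "(real ^ 'v \<Rightarrow> real ^ 'v) \<Rightarrow> real \<Rightarrow> bool" where
  "eigenvalue f \<mu> \<longleftrightarrow> (\<exists>v. v \<noteq> 0 \<and> f v = \<mu> *\<^sub>R v)"

text \<open>All real eigenvalues in nondecreasing order, each repeated according to its geometric
  multiplicity. The normalized Laplacian is self-adjoint for the inner product weighted by the
  degrees, so for it geometric and algebraic multiplicities agree.\<close>

definition sorted_eigenvalues :: "(real ^ 'v \<Rightarrow> real ^ 'v::finite) \<Rightarrow> real list" where
  "sorted_eigenvalues f =
     sorted_list_of_multiset (\<Sum>\<mu> | eigenvalue f \<mu>. replicate_mset (dim (eigenspace f \<mu>)) \<mu>)"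

text \<open>The list \<open>ks\<close> is the tuple \<open>(k\<^sub>1, \<dots>, k\<^bsub>l-1\<^esub>)\<close> of intermediate vertices of a walk of length
  \<open>l\<close> from \<open>i\<close> to \<open>j\<close>. For \<open>l = 1\<close> only the empty list occurs, and the value is \<open>w i j\<close>. The case
  \<open>l = 0\<close> is meaningless.\<close>

definition nbhd_weight :: "('v::finite \<Rightarrow> 'v \<Rightarrow> real) \<Rightarrow> nat \<Rightarrow> 'v \<Rightarrow> 'v \<Rightarrow> real" where
  "nbhd_weight w l i j =
     (\<Sum>ks | length ks = l - 1.
        (\<Prod>k\<leftarrow>ks. 1 / degree w k) *
        (\<Prod>m<l. w ((i # ks @ [j]) ! m) ((i # ks @ [j]) ! Suc m)))"

definition cheeger :: "('v::finite \<Rightarrow> 'v \<Rightarrow> real) \<Rightarrow> real" where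
  "cheeger w = Min ((\<lambda>U. (\<Sum>k\<in>U. \<Sum>m\<in>-U. w k m) /
                       min (\<Sum>i\<in>U. degree w i) (\<Sum>i\<in>-U. degree w i)) ` {U. U \<noteq> {} \<and> -U \<noteq> {}})"

end

(* The walk operator P = I - \<Delta> satisfies (D P^l)_ij = w_ij[l], so \<Gamma>[l] has the degrees of \<Gamma>, and an
   eigenvector of \<Delta> for \<lambda> is an eigenvector of the walk operator P^l of \<Gamma>[l] for (1 - \<lambda>)^l. For
   \<lambda> \<noteq> 0 it is orthogonal to the constants, so Cheeger's inequality in the form
   \<mu> \<le> sqrt(1 - h^2) for the nontrivial eigenvalues \<mu> of a walk operator, applied to \<Gamma>[l], bounds
   (1 - \<lambda>)^l. Cheeger's inequality itself comes from testing the coarea inequality on the square of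
   the positive part of the eigenvector (after a sign change, supported on at most half of the
   volume) and from Cauchy-Schwarz applied to |g_i^2 - g_j^2| = |g_i - g_j| (g_i + g_j). That the
   eigenvalues, counted with multiplicity, are CARD('v) many is the spectral theorem, proved by
   maximising the Rayleigh quotient. *)

theory Submission
  imports Defs
begin

subsection \<open>Eigenbases of self-adjoint maps\<close>

text \<open>A maximiser \<open>u\<close> of \<open>x \<bullet> f x\<close> on the unit sphere of
  \<open>S\<close> is an eigenvector: the first variation at \<open>u\<close> vanishes in every
  direction of \<open>S\<close>, and by invariance the residual
  \<open>\<mu> *\<^sub>R u - f u\<close> is such a direction.\<close>

lemma self_adjoint_eigenvector_exists:
  fixes f :: "'a::euclidean_space \<Rightarrow> 'a"
  assumes "linear f" and sym: "\<And>x y. f x \<bullet> y = x \<bullet> f y"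
    and S: "subspace S" "S \<noteq> {0}" and inv: "\<And>x. x \<in> S \<Longrightarrow> f x \<in> S"
  obtains u \<mu> where "u \<in> S" "u \<noteq> 0" "f u = \<mu> *\<^sub>R u"
proof -
  interpret f: linear f by fact
  have comp: "compact (sphere 0 1 \<inter> S)"
    using closed_subspace[OF S(1)] by (simp add: compact_Int_closed)
  obtain x where x: "x \<in> S" "x \<noteq> 0"
    using S subspace_0 by blast
  have "(1 / norm x) *\<^sub>R x \<in> sphere 0 1 \<inter> S"
    using x S(1) by (simp add: subspace_scale)
  then have ne: "sphere 0 1 \<inter> S \<noteq> {}" by blast
  have "continuous_on (sphere 0 1 \<inter> S) (\<lambda>x. x \<bullet> f x)"
    by (intro continuous_intros linear_continuous_on linear_conv_bounded_linear[THEN iffD1] assms(1))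
  then obtain u where u: "u \<in> sphere 0 1 \<inter> S"
    and max: "\<And>y. y \<in> sphere 0 1 \<inter> S \<Longrightarrow> y \<bullet> f y \<le> u \<bullet> f u"
    using continuous_attains_sup[OF comp ne] by blast
  define \<mu> where "\<mu> = u \<bullet> f u"
  \<comment> \<open>\<open>q\<close> is homogeneous of degree two, so maximality on the sphere makes
    it nonnegative on all of \<open>S\<close>, with value 0 at \<open>u\<close>.\<close>
  define q where "q x = \<mu> * (x \<bullet> x) - x \<bullet> f x" for x
  have uu: "u \<bullet> u = 1" "u \<in> S" using u by (auto simp: dot_square_norm)
  have q_nonneg: "q y \<ge> 0" if "y \<in> S" for y
  proof (cases "y = 0")
    case False
    have "(1 / norm y) *\<^sub>R y \<in> sphere 0 1 \<inter> S"
      using that False S(1) by (simp add: subspace_scale)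
    from max[OF this] have "(y \<bullet> f y) / (norm y)\<^sup>2 \<le> \<mu>"
      by (simp add: f.scale \<mu>_def power2_eq_square)
    then show ?thesis
      using False by (simp add: q_def dot_square_norm field_simps)
  qed (simp add: q_def)
  \<comment> \<open>Along \<open>u + t *\<^sub>R y\<close> the linear coefficient of
    \<open>q\<close> is twice the squared norm of the residual \<open>y\<close>; nonnegativity for
    small negative and positive \<open>t\<close> forces it to vanish.\<close>
  define y where "y = \<mu> *\<^sub>R u - f u"
  have yS: "y \<in> S" unfolding y_def using S(1) uu inv by (simp add: subspace_diff subspace_scale)
  define c where "c = y \<bullet> y"
  have expand: "q (u + t *\<^sub>R y) = 2 * t * c + t\<^sup>2 * q y" for t
  proof -
    have "c = \<mu> * (u \<bullet> y) - y \<bullet> f u"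
    proof -
      have "c = y \<bullet> (\<mu> *\<^sub>R u - f u)" by (simp only: c_def flip: y_def)
      then show ?thesis by (simp add: inner_diff_right inner_commute)
    qed
    moreover have "y \<bullet> f u = u \<bullet> f y" by (metis sym inner_commute)
    ultimately have c: "c = \<mu> * (u \<bullet> y) - u \<bullet> f y" by simp
    have "q (u + t *\<^sub>R y) = 2 * t * (\<mu> * (u \<bullet> y) - u \<bullet> f y) + t\<^sup>2 * q y"
      using uu \<open>y \<bullet> f u = u \<bullet> f y\<close>
      by (simp add: q_def f.add f.scale inner_add_left inner_add_right inner_commute[of y u]
          \<mu>_def[symmetric] algebra_simps power2_eq_square)
    then show ?thesis by (simp only: c)
  qed
  have "c = 0"
  proof (rule ccontr)
    assume "c \<noteq> 0"
    then have "c\<^sup>2 > 0" by simp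
    \<comment> \<open>Adding 1 keeps the denominator positive even if \<open>q y = 0\<close>; then
      \<open>t = - c / Q\<close> is a step short enough for the linear term to dominate.\<close>
    define Q where "Q = q y + 1"
    have Q: "Q \<ge> 1" using q_nonneg[OF yS] by (simp add: Q_def)
    have "q (u + (- c / Q) *\<^sub>R y) \<ge> 0"
      using yS uu S(1) by (intro q_nonneg) (simp add: subspace_add subspace_scale del: divide_minus_left)
    also have "q (u + (- c / Q) *\<^sub>R y) = (c\<^sup>2 / Q\<^sup>2) * (- Q - 1)"
    proof -
      have "q y = Q - 1" by (simp add: Q_def)
      show ?thesis unfolding expand \<open>q y = Q - 1\<close> using Q by (simp add: field_simps power2_eq_square)
    qed
    also have "\<dots> < 0"
      using \<open>c\<^sup>2 > 0\<close> Q by (intro mult_pos_neg) auto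
    finally show False by simp
  qed
  then have "f u = \<mu> *\<^sub>R u" by (simp add: c_def y_def)
  with uu show thesis by (intro that[of u \<mu>]) auto
qed

text \<open>An orthogonal set of eigenvectors of maximal cardinality spans: its orthogonal
  complement is invariant by symmetry of \<open>f\<close>, and if it were nonzero it would contain
  one more eigenvector.\<close>

lemma self_adjoint_eigenbasis:
  fixes f :: "'a::euclidean_space \<Rightarrow> 'a"
  assumes "linear f" and sym: "\<And>x y. f x \<bullet> y = x \<bullet> f y"
  obtains B m where "independent B" "span B = UNIV" "\<And>b. b \<in> B \<Longrightarrow> f b = m b *\<^sub>R b"
proof -
  define ok where "ok B \<longleftrightarrow> pairwise orthogonal B \<and> 0 \<notin> B \<and> (\<forall>b\<in>B. \<exists>\<mu>. f b = \<mu> *\<^sub>R b)" for B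
  have indep: "independent B" if "ok B" for B
    using that pairwise_orthogonal_independent by (auto simp: ok_def)
  have "ok {}" by (simp add: ok_def)
  \<comment> \<open>Orthogonal nonzero vectors are independent, so the dimension bounds the
    cardinality and a largest such set exists.\<close>
  moreover have "\<forall>B. ok B \<longrightarrow> card B < Suc DIM('a)"
    using indep independent_bound by (auto simp: less_Suc_eq_le)
  ultimately obtain B where B: "ok B" and max: "\<And>C. ok C \<Longrightarrow> card C \<le> card B"
    using ex_has_greatest_nat[of ok "{}" card "Suc DIM('a)"] by metis
  have fin: "finite B" using indep[OF B] independent_bound by blast
  define S where "S = {x. \<forall>b\<in>B. b \<bullet> x = 0}"
  have S: "subspace S" unfolding S_def by (auto simp: subspace_def inner_add_right)
  have inv: "f x \<in> S" if "x \<in> S" for x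
    unfolding S_def
  proof safe
    fix b assume b: "b \<in> B"
    then obtain \<mu> where "f b = \<mu> *\<^sub>R b" using B by (auto simp: ok_def)
    then show "b \<bullet> f x = 0" using that b by (simp add: sym[symmetric] S_def)
  qed
  have "S = {0}"
  proof (rule ccontr)
    assume "S \<noteq> {0}"
    then obtain u \<mu> where u: "u \<in> S" "u \<noteq> 0" "f u = \<mu> *\<^sub>R u"
      using self_adjoint_eigenvector_exists[OF assms S _ inv] by blast
    have "u \<notin> B" using u by (auto simp: S_def)
    moreover have "ok (insert u B)"
      using B u by (auto simp: ok_def pairwise_insert S_def orthogonal_def inner_commute)
    ultimately show False using max[of "insert u B"] fin by simp
  qed
  have "span B = UNIV"
  proof (rule ccontr)
    assume "span B \<noteq> UNIV"
    then obtain a where "a \<noteq> 0" "\<forall>x\<in>span B. a \<bullet> x = 0"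
      using span_not_UNIV_orthogonal by blast
    then have "a \<in> S" by (auto simp: S_def inner_commute span_base)
    with \<open>S = {0}\<close> \<open>a \<noteq> 0\<close> show False by blast
  qed
  moreover obtain m where "\<And>b. b \<in> B \<Longrightarrow> f b = m b *\<^sub>R b"
    using B unfolding ok_def by metis
  ultimately show thesis using indep[OF B] that by blast
qed

text \<open>Applying \<open>f\<close> minus \<open>\<mu>\<close> to the expansion of an eigenvector
  in \<open>B\<close> multiplies each coefficient by \<open>m b - \<mu>\<close>; independence then
  kills the coefficients with \<open>m b \<noteq> \<mu>\<close>.\<close>

lemma eigenspace_eigenbasis:
  fixes f :: "real ^ 'v::finite \<Rightarrow> real ^ 'v"
  assumes "linear f" "independent B" "span B = UNIV" and m: "\<And>b. b \<in> B \<Longrightarrow> f b = m b *\<^sub>R b"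
  shows "eigenspace f \<mu> = span {b \<in> B. m b = \<mu>}"
proof
  interpret f: linear f by fact
  have fin: "finite B" using assms(2) independent_bound by blast
  show "eigenspace f \<mu> \<subseteq> span {b \<in> B. m b = \<mu>}"
  proof
    fix v assume "v \<in> eigenspace f \<mu>"
    then have fv: "f v = \<mu> *\<^sub>R v" by (simp add: eigenspace_def)
    have "v \<in> span B" using assms(3) by simp
    then obtain c where v: "v = (\<Sum>b\<in>B. c b *\<^sub>R b)"
      using span_finite[OF fin] by auto
    have "(\<Sum>b\<in>B. (c b * (m b - \<mu>)) *\<^sub>R b) = f v - \<mu> *\<^sub>R v"
      unfolding v f.sum scaleR_sum_right sum_subtractf[symmetric]
      by (intro sum.cong refl) (simp add: f.scale m algebra_simps)
    with fv have zero: "(\<Sum>b\<in>B. (c b * (m b - \<mu>)) *\<^sub>R b) = 0" by simp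
    have "c b * (m b - \<mu>) = 0" if "b \<in> B" for b
      using independentD[OF assms(2) fin subset_refl zero that] .
    then have "c b *\<^sub>R b \<in> span {b \<in> B. m b = \<mu>}" if "b \<in> B" for b
      using that by (cases "m b = \<mu>") (force intro: span_base span_scale span_zero)+
    then show "v \<in> span {b \<in> B. m b = \<mu>}"
      unfolding v by (rule span_sum)
  qed
  have "subspace (eigenspace f \<mu>)"
    by (auto simp: subspace_def eigenspace_def f.add f.scale algebra_simps)
  moreover have "{b \<in> B. m b = \<mu>} \<subseteq> eigenspace f \<mu>"
    using m by (auto simp: eigenspace_def)
  ultimately show "span {b \<in> B. m b = \<mu>} \<subseteq> eigenspace f \<mu>"
    by (rule span_minimal[rotated])
qed

text \<open>The eigenvalues are the values of \<open>m\<close> on \<open>B\<close>, and the fibres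
  of \<open>m\<close> partition \<open>B\<close> into bases of the eigenspaces.\<close>

lemma
  fixes f :: "real ^ 'v::finite \<Rightarrow> real ^ 'v"
  assumes "linear f" "independent B" "span B = UNIV" and m: "\<And>b. b \<in> B \<Longrightarrow> f b = m b *\<^sub>R b"
  shows finite_eigenvalues_eigenbasis: "finite {\<mu>. eigenvalue f \<mu>}"
    and sum_dim_eigenspaces_eigenbasis: "(\<Sum>\<mu> | eigenvalue f \<mu>. dim (eigenspace f \<mu>)) = CARD('v)"
proof -
  have fin: "finite B" using assms(2) independent_bound by blast
  have eigenspace: "eigenspace f \<mu> = span {b \<in> B. m b = \<mu>}" for \<mu>
    using assms by (rule eigenspace_eigenbasis)
  have "eigenvalue f \<mu> \<longleftrightarrow> \<mu> \<in> m ` B" for \<mu>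
  proof
    assume "eigenvalue f \<mu>"
    then have "\<not> span {b \<in> B. m b = \<mu>} \<subseteq> {0}"
      by (auto simp: eigenspace[symmetric] eigenvalue_def eigenspace_def)
    then have "{b \<in> B. m b = \<mu>} \<noteq> {}" by fastforce
    then show "\<mu> \<in> m ` B" by blast
  next
    assume "\<mu> \<in> m ` B"
    then obtain b where "b \<in> B" "\<mu> = m b" by blast
    moreover from this have "b \<noteq> 0" using dependent_zero[of B] assms(2) by metis
    ultimately show "eigenvalue f \<mu>"
      using m unfolding eigenvalue_def by metis
  qed
  then have ev: "{\<mu>. eigenvalue f \<mu>} = m ` B" by blast
  then show "finite {\<mu>. eigenvalue f \<mu>}" using fin by simp
  have "(\<Sum>\<mu> | eigenvalue f \<mu>. dim (eigenspace f \<mu>)) = (\<Sum>\<mu>\<in>m ` B. card {b \<in> B. m b = \<mu>})"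
    unfolding ev
  proof (rule sum.cong[OF refl])
    fix \<mu>
    have "independent {b \<in> B. m b = \<mu>}"
      by (rule independent_mono[OF assms(2)]) auto
    then show "dim (eigenspace f \<mu>) = card {b \<in> B. m b = \<mu>}"
      unfolding eigenspace by (rule dim_span_eq_card_independent)
  qed
  also have "\<dots> = card B"
    using sum.image_gen[OF fin, of "\<lambda>_. 1::nat" m] by simp
  also have "\<dots> = CARD('v)"
    using dim_eq_card[of B UNIV] assms by simp
  finally show "(\<Sum>\<mu> | eigenvalue f \<mu>. dim (eigenspace f \<mu>)) = CARD('v)" .
qed

text \<open>Finiteness ensures that the sum of multisets in \<open>sorted_eigenvalues\<close> is not
  the default empty one; each eigenvalue then receives its multiplicity from exactly one
  summand.\<close>

lemma
  assumes fin: "finite {\<mu>. eigenvalue f \<mu>}"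
  shows length_sorted_eigenvalues:
      "length (sorted_eigenvalues f) = (\<Sum>\<mu> | eigenvalue f \<mu>. dim (eigenspace f \<mu>))"
    and count_sorted_eigenvalues:
      "eigenvalue f \<mu> \<Longrightarrow> count_list (sorted_eigenvalues f) \<mu> = dim (eigenspace f \<mu>)"
    and set_sorted_eigenvalues: "set (sorted_eigenvalues f) \<subseteq> {\<mu>. eigenvalue f \<mu>}"
proof -
  let ?M = "\<Sum>\<mu> | eigenvalue f \<mu>. replicate_mset (dim (eigenspace f \<mu>)) \<mu>"
  have mset: "mset (sorted_eigenvalues f) = ?M"
    by (simp add: sorted_eigenvalues_def)
  have "length (sorted_eigenvalues f) = size ?M"
    by (metis mset size_mset)
  then show "length (sorted_eigenvalues f) = (\<Sum>\<mu> | eigenvalue f \<mu>. dim (eigenspace f \<mu>))"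
    by simp
  have count: "count_list (sorted_eigenvalues f) \<mu> = (if eigenvalue f \<mu> then dim (eigenspace f \<mu>) else 0)" for \<mu>
  proof -
    have "count_list (sorted_eigenvalues f) \<mu> = count ?M \<mu>"
      by (metis mset count_mset)
    also have "\<dots> = (\<Sum>\<nu> | eigenvalue f \<nu>. if \<nu> = \<mu> then dim (eigenspace f \<mu>) else 0)"
      unfolding count_sum by (intro sum.cong) auto
    finally show ?thesis using fin by simp
  qed
  then show "eigenvalue f \<mu> \<Longrightarrow> count_list (sorted_eigenvalues f) \<mu> = dim (eigenspace f \<mu>)"
    by simp
  show "set (sorted_eigenvalues f) \<subseteq> {\<mu>. eigenvalue f \<mu>}"
    using count by (auto split: if_splits) (metis count_list_0_iff)
qed

subsection \<open>Cheeger's inequality\<close>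

text \<open>These properties pass from a graph to its neighborhood graphs, so Cheeger's inequality
  can be instantiated at both. Connectedness would not pass on: for a bipartite graph and even
  \<open>l\<close> it is lost.\<close>

locale weight_function =
  fixes w :: "'v::finite \<Rightarrow> 'v \<Rightarrow> real"
  assumes weight_sym: "w i j = w j i"
    and weight_nonneg: "0 \<le> w i j"
    and degree_pos: "0 < degree w i"
begin

lemma volume_pos: "U \<noteq> {} \<Longrightarrow> 0 < (\<Sum>i\<in>U. degree w i)"
  by (intro sum_pos degree_pos) auto

text \<open>The set \<open>U\<close> witnesses that \<open>Min\<close> ranges over a nonempty set,
  so the minimum is one of the quotients.\<close>

lemma cheeger_nonneg:
  fixes U :: "'v set"
  assumes "U \<noteq> {}" "-U \<noteq> {}"
  shows "0 \<le> cheeger w"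
proof -
  let ?q = "\<lambda>U. (\<Sum>k\<in>U. \<Sum>m\<in>-U. w k m) / min (\<Sum>i\<in>U. degree w i) (\<Sum>i\<in>-U. degree w i)"
  have "cheeger w \<in> ?q ` {U. U \<noteq> {} \<and> -U \<noteq> {}}"
    unfolding cheeger_def using assms by (intro Min_in finite_imageI finite) blast
  moreover have "0 \<le> ?q U" for U
    by (intro divide_nonneg_nonneg sum_nonneg weight_nonneg min.boundedI less_imp_le[OF degree_pos])
  ultimately show ?thesis by auto
qed

lemma cheeger_volume_le_cut:
  assumes "U \<noteq> {}" "-U \<noteq> {}" "(\<Sum>i\<in>U. degree w i) \<le> (\<Sum>i\<in>-U. degree w i)"
  shows "cheeger w * (\<Sum>i\<in>U. degree w i) \<le> (\<Sum>k\<in>U. \<Sum>m\<in>-U. w k m)"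
proof -
  have "cheeger w \<le> (\<Sum>k\<in>U. \<Sum>m\<in>-U. w k m) / min (\<Sum>i\<in>U. degree w i) (\<Sum>i\<in>-U. degree w i)"
    unfolding cheeger_def using assms by (intro Min_le imageI[of U] finite_imageI finite) blast
  then show ?thesis
    using assms volume_pos[of U] by (simp add: min_absorb1 field_simps)
qed

text \<open>The double sum meets every boundary edge in both orientations, which contribute equally
  by symmetry of \<open>w\<close>.\<close>

lemma sum_weight_boundary:
  "(\<Sum>i\<in>UNIV. \<Sum>j\<in>UNIV. w i j * of_bool ((i \<in> S) \<noteq> (j \<in> S))) = 2 * (\<Sum>k\<in>S. \<Sum>m\<in>-S. w k m)"
proof -
  have cut: "(\<Sum>i\<in>UNIV. \<Sum>j\<in>UNIV. w i j * (of_bool (i \<in> S) * of_bool (j \<notin> S)))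
      = (\<Sum>k\<in>S. \<Sum>m\<in>-S. w k m)"
  proof -
    have "w i j * (of_bool (i \<in> S) * of_bool (j \<notin> S)) = (if i \<in> S then if j \<in> -S then w i j else 0 else 0)" for i j
      by simp
    moreover have "(\<Sum>j\<in>UNIV. if i \<in> S then if j \<in> -S then w i j else 0 else 0)
        = (if i \<in> S then \<Sum>m\<in>-S. w i m else 0)" for i
      using sum.inter_restrict[of UNIV "w i" "-S"] by simp
    ultimately show ?thesis
      using sum.inter_restrict[of UNIV "\<lambda>i. \<Sum>m\<in>-S. w i m" S] by (simp only: Int_UNIV_left finite)
  qed
  have "(\<Sum>i\<in>UNIV. \<Sum>j\<in>UNIV. w i j * of_bool ((i \<in> S) \<noteq> (j \<in> S)))
      = (\<Sum>i\<in>UNIV. \<Sum>j\<in>UNIV. w i j * (of_bool (i \<in> S) * of_bool (j \<notin> S)))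
      + (\<Sum>i\<in>UNIV. \<Sum>j\<in>UNIV. w i j * (of_bool (j \<in> S) * of_bool (i \<notin> S)))"
    unfolding sum.distrib[symmetric] by (intro sum.cong) auto
  also have "(\<Sum>i\<in>UNIV. \<Sum>j\<in>UNIV. w i j * (of_bool (j \<in> S) * of_bool (i \<notin> S)))
      = (\<Sum>i\<in>UNIV. \<Sum>j\<in>UNIV. w i j * (of_bool (i \<in> S) * of_bool (j \<notin> S)))"
    by (subst sum.swap) (simp add: weight_sym)
  finally show ?thesis by (simp add: cut)
qed

text \<open>Discrete coarea inequality: the induction peels off the lowest level of \<open>\<phi>\<close> on its support.\<close>

lemma cheeger_total_variation:
  assumes "\<And>i. 0 \<le> \<phi> i"
    and "(\<Sum>i | \<phi> i > 0. degree w i) \<le> (\<Sum>i\<in>-{i. \<phi> i > 0}. degree w i)"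
  shows "2 * cheeger w * (\<Sum>i\<in>UNIV. degree w i * \<phi> i)
    \<le> (\<Sum>i\<in>UNIV. \<Sum>j\<in>UNIV. w i j * \<bar>\<phi> i - \<phi> j\<bar>)"
  using assms
proof (induction "card {i. \<phi> i > 0}" arbitrary: \<phi> rule: less_induct)
  case less
  note nonneg = less.prems(1)
  define S where "S = {i. \<phi> i > 0}"
  have outside: "\<phi> i = 0" if "i \<notin> S" for i
    using nonneg[of i] that by (simp add: S_def)
  show ?case
  proof (cases "S = {}")
    case True
    then have "\<phi> i = 0" for i using outside by simp
    then show ?thesis by simp
  next
    case False
    have vol: "(\<Sum>i\<in>S. degree w i) \<le> (\<Sum>i\<in>-S. degree w i)"
      using less.prems(2) by (simp add: S_def)
    have "-S \<noteq> {}" using vol volume_pos[OF False] by auto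
    \<comment> \<open>\<open>t\<close> is the lowest positive level of \<open>\<phi>\<close>.
      Subtracting it on \<open>S\<close> annihilates the minimiser \<open>s\<close>, so the support
      shrinks strictly and the induction applies.\<close>
    define t where "t = Min (\<phi> ` S)"
    have "t \<in> \<phi> ` S" unfolding t_def using False by (intro Min_in) auto
    then obtain s where s: "s \<in> S" "\<phi> s = t" by blast
    have t_le: "t \<le> \<phi> i" if "i \<in> S" for i
      using that by (simp add: t_def)
    have "t > 0" using s by (auto simp: S_def)
    define \<psi> where "\<psi> i = \<phi> i - t * of_bool (i \<in> S)" for i
    have sub: "{i. \<psi> i > 0} \<subset> S"
    proof -
      have "\<psi> s = 0" using s by (simp add: \<psi>_def)
      moreover have "i \<in> S" if "\<psi> i > 0" for i
        using that outside[of i] by (cases "i \<in> S") (simp_all add: \<psi>_def)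
      ultimately show ?thesis using s(1) by force
    qed
    \<comment> \<open>The volume condition is inherited by the smaller support, whose complement
      only grows.\<close>
    have "(\<Sum>i | \<psi> i > 0. degree w i) \<le> (\<Sum>i\<in>S. degree w i)"
      using sub by (intro sum_mono2 less_imp_le[OF degree_pos]) auto
    also note vol
    also have "(\<Sum>i\<in>-S. degree w i) \<le> (\<Sum>i\<in>-{i. \<psi> i > 0}. degree w i)"
      using sub by (intro sum_mono2 less_imp_le[OF degree_pos]) auto
    finally have IH: "2 * cheeger w * (\<Sum>i\<in>UNIV. degree w i * \<psi> i)
        \<le> (\<Sum>i\<in>UNIV. \<Sum>j\<in>UNIV. w i j * \<bar>\<psi> i - \<psi> j\<bar>)"
    proof (intro less.hyps)
      show "card {i. \<psi> i > 0} < card {i. \<phi> i > 0}"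
        using psubset_card_mono[OF _ sub] by (simp add: S_def)
      show "0 \<le> \<psi> i" for i
        using t_le[of i] outside[of i] by (cases "i \<in> S") (simp_all add: \<psi>_def)
    qed
    \<comment> \<open>Differences within \<open>S\<close> and within its complement are unchanged.
      Across the boundary one value is 0 and the other at least \<open>t\<close>, so the difference
      drops by exactly \<open>t\<close>.\<close>
    have split: "\<bar>\<phi> i - \<phi> j\<bar> = \<bar>\<psi> i - \<psi> j\<bar> + t * of_bool ((i \<in> S) \<noteq> (j \<in> S))" for i j
      using t_le[of i] t_le[of j] outside[of i] outside[of j] \<open>t > 0\<close>
      by (cases "i \<in> S"; cases "j \<in> S") (simp_all add: \<psi>_def)
    have "2 * cheeger w * (\<Sum>i\<in>UNIV. degree w i * \<phi> i)
        = 2 * cheeger w * (\<Sum>i\<in>UNIV. degree w i * \<psi> i)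
          + 2 * t * (cheeger w * (\<Sum>i\<in>S. degree w i))"
    proof -
      have "(\<Sum>i\<in>UNIV. degree w i * \<phi> i)
          = (\<Sum>i\<in>UNIV. degree w i * \<psi> i + t * (if i \<in> S then degree w i else 0))"
        by (intro sum.cong) (auto simp: \<psi>_def algebra_simps)
      also have "\<dots> = (\<Sum>i\<in>UNIV. degree w i * \<psi> i) + t * (\<Sum>i\<in>S. degree w i)"
        unfolding sum.distrib sum_distrib_left[symmetric]
        using sum.inter_restrict[of UNIV "degree w" S] by simp
      finally show ?thesis by (simp add: algebra_simps)
    qed
    \<comment> \<open>The induction hypothesis covers the part above level \<open>t\<close>, and the
      quotient of the single set \<open>S\<close> covers the layer below it.\<close>
    also have "\<dots> \<le> (\<Sum>i\<in>UNIV. \<Sum>j\<in>UNIV. w i j * \<bar>\<psi> i - \<psi> j\<bar>)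
        + 2 * t * (\<Sum>k\<in>S. \<Sum>m\<in>-S. w k m)"
      using IH cheeger_volume_le_cut[OF False \<open>-S \<noteq> {}\<close> vol] \<open>t > 0\<close>
      by (intro add_mono mult_left_mono) auto
    also have "2 * t * (\<Sum>k\<in>S. \<Sum>m\<in>-S. w k m)
        = t * (\<Sum>i\<in>UNIV. \<Sum>j\<in>UNIV. w i j * of_bool ((i \<in> S) \<noteq> (j \<in> S)))"
      unfolding sum_weight_boundary by simp
    also have "(\<Sum>i\<in>UNIV. \<Sum>j\<in>UNIV. w i j * \<bar>\<psi> i - \<psi> j\<bar>) + \<dots>
        = (\<Sum>i\<in>UNIV. \<Sum>j\<in>UNIV. w i j * \<bar>\<phi> i - \<phi> j\<bar>)"
    proof -
      have "w i j * \<bar>\<phi> i - \<phi> j\<bar>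
          = w i j * \<bar>\<psi> i - \<psi> j\<bar> + t * (w i j * of_bool ((i \<in> S) \<noteq> (j \<in> S)))" for i j
        unfolding split by (simp only: distrib_left mult.left_commute)
      then show ?thesis by (simp only: sum.distrib sum_distrib_left)
    qed
    finally show ?thesis .
  qed
qed

section \<open>Quadratic forms of the weights and Cauchy-Schwarz\<close>

lemma sum_weight_sq:
  "(\<Sum>i\<in>UNIV. \<Sum>j\<in>UNIV. w i j * (g i)\<^sup>2) = (\<Sum>i\<in>UNIV. degree w i * (g i)\<^sup>2)"
  "(\<Sum>i\<in>UNIV. \<Sum>j\<in>UNIV. w i j * (g j)\<^sup>2) = (\<Sum>i\<in>UNIV. degree w i * (g i)\<^sup>2)"
proof -
  show *: "(\<Sum>i\<in>UNIV. \<Sum>j\<in>UNIV. w i j * (g i)\<^sup>2) = (\<Sum>i\<in>UNIV. degree w i * (g i)\<^sup>2)"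
    by (simp add: degree_def sum_distrib_right)
  show "(\<Sum>i\<in>UNIV. \<Sum>j\<in>UNIV. w i j * (g j)\<^sup>2) = (\<Sum>i\<in>UNIV. degree w i * (g i)\<^sup>2)"
    unfolding *[symmetric] by (subst sum.swap) (simp add: weight_sym)
qed

lemma sum_weight_sq_diff:
  "(\<Sum>i\<in>UNIV. \<Sum>j\<in>UNIV. w i j * (g i - g j)\<^sup>2)
    = 2 * (\<Sum>i\<in>UNIV. degree w i * (g i)\<^sup>2) - 2 * (\<Sum>i\<in>UNIV. \<Sum>j\<in>UNIV. w i j * g i * g j)"
proof -
  have "(\<Sum>i\<in>UNIV. \<Sum>j\<in>UNIV. w i j * (g i - g j)\<^sup>2)
      = (\<Sum>i\<in>UNIV. \<Sum>j\<in>UNIV. w i j * (g i)\<^sup>2 + w i j * (g j)\<^sup>2 - 2 * (w i j * g i * g j))"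
    by (intro sum.cong refl) (simp add: power2_eq_square algebra_simps)
  also have "\<dots> = (\<Sum>i\<in>UNIV. \<Sum>j\<in>UNIV. w i j * (g i)\<^sup>2) + (\<Sum>i\<in>UNIV. \<Sum>j\<in>UNIV. w i j * (g j)\<^sup>2)
      - 2 * (\<Sum>i\<in>UNIV. \<Sum>j\<in>UNIV. w i j * g i * g j)"
    by (simp only: sum.distrib sum_subtractf sum_distrib_left)
  finally show ?thesis by (simp only: sum_weight_sq)
qed

lemma sum_weight_sq_add:
  "(\<Sum>i\<in>UNIV. \<Sum>j\<in>UNIV. w i j * (g i + g j)\<^sup>2)
    = 2 * (\<Sum>i\<in>UNIV. degree w i * (g i)\<^sup>2) + 2 * (\<Sum>i\<in>UNIV. \<Sum>j\<in>UNIV. w i j * g i * g j)"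
proof -
  have "(\<Sum>i\<in>UNIV. \<Sum>j\<in>UNIV. w i j * (g i + g j)\<^sup>2)
      = (\<Sum>i\<in>UNIV. \<Sum>j\<in>UNIV. w i j * (g i)\<^sup>2 + w i j * (g j)\<^sup>2 + 2 * (w i j * g i * g j))"
    by (intro sum.cong refl) (simp add: power2_eq_square algebra_simps)
  also have "\<dots> = (\<Sum>i\<in>UNIV. \<Sum>j\<in>UNIV. w i j * (g i)\<^sup>2) + (\<Sum>i\<in>UNIV. \<Sum>j\<in>UNIV. w i j * (g j)\<^sup>2)
      + 2 * (\<Sum>i\<in>UNIV. \<Sum>j\<in>UNIV. w i j * g i * g j)"
    by (simp only: sum.distrib sum_distrib_left)
  finally show ?thesis by (simp only: sum_weight_sq)
qed

text \<open>Let A be the sum of \<open>degree w i * (g i)\<^sup>2\<close> and C that of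
  \<open>w i j * g i * g j\<close>. Cauchy-Schwarz over ordered pairs, with the weight split into
  two square roots, gives the factors 2 (A - C) and 2 (A + C), whose product is 4 (A^2 -
  C^2).\<close>

lemma sq_total_variation_le:
  assumes "\<And>i. 0 \<le> g i"
  shows "(\<Sum>i\<in>UNIV. \<Sum>j\<in>UNIV. w i j * \<bar>(g i)\<^sup>2 - (g j)\<^sup>2\<bar>)\<^sup>2
    \<le> 4 * ((\<Sum>i\<in>UNIV. degree w i * (g i)\<^sup>2)\<^sup>2 - (\<Sum>i\<in>UNIV. \<Sum>j\<in>UNIV. w i j * g i * g j)\<^sup>2)"
proof -
  define a where "a = (\<lambda>(i, j). sqrt (w i j) * \<bar>g i - g j\<bar>)"
  define b where "b = (\<lambda>(i, j). sqrt (w i j) * (g i + g j))"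
  have ab: "a (i, j) * b (i, j) = w i j * \<bar>(g i)\<^sup>2 - (g j)\<^sup>2\<bar>" for i j
  proof -
    have "\<bar>(g i)\<^sup>2 - (g j)\<^sup>2\<bar> = \<bar>g i - g j\<bar> * (g i + g j)"
      using assms[of i] assms[of j] by (simp add: power2_eq_square square_diff_square_factored abs_mult)
    moreover have "a (i, j) * b (i, j) = (sqrt (w i j))\<^sup>2 * (\<bar>g i - g j\<bar> * (g i + g j))"
      by (simp only: a_def b_def power2_eq_square prod.case mult_ac)
    ultimately show ?thesis using weight_nonneg by simp
  qed
  have a2: "(a (i, j))\<^sup>2 = w i j * (g i - g j)\<^sup>2" for i j
    using weight_nonneg by (simp add: a_def power_mult_distrib)
  have b2: "(b (i, j))\<^sup>2 = w i j * (g i + g j)\<^sup>2" for i j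
    using weight_nonneg by (simp add: b_def power_mult_distrib)
  have "(\<Sum>p\<in>UNIV \<times> UNIV. a p * b p)\<^sup>2 \<le> (\<Sum>p\<in>UNIV \<times> UNIV. (a p)\<^sup>2) * (\<Sum>p\<in>UNIV \<times> UNIV. (b p)\<^sup>2)"
    by (rule Cauchy_Schwarz_ineq_sum)
  also have "(\<Sum>p\<in>UNIV \<times> UNIV. (a p)\<^sup>2) = (\<Sum>i\<in>UNIV. \<Sum>j\<in>UNIV. w i j * (g i - g j)\<^sup>2)"
    by (simp only: sum.cartesian_product' a2)
  also have "(\<Sum>p\<in>UNIV \<times> UNIV. (b p)\<^sup>2) = (\<Sum>i\<in>UNIV. \<Sum>j\<in>UNIV. w i j * (g i + g j)\<^sup>2)"
    by (simp only: sum.cartesian_product' b2)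
  also have "(\<Sum>p\<in>UNIV \<times> UNIV. a p * b p) = (\<Sum>i\<in>UNIV. \<Sum>j\<in>UNIV. w i j * \<bar>(g i)\<^sup>2 - (g j)\<^sup>2\<bar>)"
    by (simp only: sum.cartesian_product' ab)
  finally show ?thesis
    unfolding sum_weight_sq_diff sum_weight_sq_add by (simp add: power2_eq_square algebra_simps)
qed

text \<open>With \<open>g\<close> the positive part of \<open>f\<close>, the coarea inequality for
  the square of \<open>g\<close> bounds \<open>T\<close> below by \<open>2 * cheeger w * A\<close>,
  Cauchy-Schwarz bounds it above, and the eigenvector equation gives
  \<open>\<mu> * A \<le> C\<close>.\<close>

lemma cheeger_inequality_half:
  assumes eigen: "\<And>i. (\<Sum>j\<in>UNIV. w i j * f j) = \<mu> * degree w i * f i"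
    and pos: "f p > 0"
    and vol: "(\<Sum>i | f i > 0. degree w i) \<le> (\<Sum>i\<in>-{i. f i > 0}. degree w i)"
  shows "(cheeger w)\<^sup>2 \<le> 1 \<and> (0 \<le> \<mu> \<longrightarrow> \<mu>\<^sup>2 \<le> 1 - (cheeger w)\<^sup>2)"
proof -
  define g where "g i = max (f i) 0" for i
  define A where "A = (\<Sum>i\<in>UNIV. degree w i * (g i)\<^sup>2)"
  define C where "C = (\<Sum>i\<in>UNIV. \<Sum>j\<in>UNIV. w i j * g i * g j)"
  define T where "T = (\<Sum>i\<in>UNIV. \<Sum>j\<in>UNIV. w i j * \<bar>(g i)\<^sup>2 - (g j)\<^sup>2\<bar>)"
  let ?h = "cheeger w"
  have g_nonneg: "0 \<le> g i" for i by (simp add: g_def)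
  have "A > 0"
    unfolding A_def using pos degree_pos
    by (intro sum_pos2[of _ p] mult_nonneg_nonneg less_imp_le[OF degree_pos]) (auto simp: g_def)
  \<comment> \<open>Squaring does not change the support, so \<open>vol\<close> is the volume
    condition of the coarea inequality.\<close>
  have supp: "{i. (g i)\<^sup>2 > 0} = {i. f i > 0}" by (auto simp: g_def max_def)
  have hT: "2 * ?h * A \<le> T"
    unfolding A_def T_def by (rule cheeger_total_variation) (use vol supp in auto)
  have ne: "{i. f i > 0} \<noteq> {}" using pos by blast
  moreover have "-{i. f i > 0} \<noteq> {}"
    using vol volume_pos[OF ne] by fastforce
  ultimately have "?h \<ge> 0" by (rule cheeger_nonneg)
  with \<open>A > 0\<close> hT have "(2 * ?h * A)\<^sup>2 \<le> T\<^sup>2"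
    by (intro power_mono) auto
  also have "\<dots> \<le> 4 * (A\<^sup>2 - C\<^sup>2)"
    unfolding A_def C_def T_def by (rule sq_total_variation_le[OF g_nonneg])
  finally have key: "C\<^sup>2 \<le> (1 - ?h\<^sup>2) * A\<^sup>2"
    by (simp add: power_mult_distrib algebra_simps)
  have "0 \<le> (1 - ?h\<^sup>2) * A\<^sup>2" using key by (rule order_trans[rotated]) simp
  then have "?h\<^sup>2 \<le> 1" using \<open>A > 0\<close> by (simp add: zero_le_mult_iff)
  moreover have "\<mu>\<^sup>2 \<le> 1 - ?h\<^sup>2" if "0 \<le> \<mu>"
  proof -
    \<comment> \<open>The eigenvector equation is tested against \<open>g\<close>, using
      \<open>g i * f i = (g i)\<^sup>2\<close>. Replacing the remaining \<open>f j\<close> by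
      \<open>g j\<close> only increases the sum, since \<open>w i j * g i\<close> is
      nonnegative.\<close>
    have "\<mu> * A = (\<Sum>i\<in>UNIV. g i * (\<mu> * degree w i * f i))"
      unfolding A_def sum_distrib_left
      by (intro sum.cong) (auto simp: g_def max_def power2_eq_square)
    also have "\<dots> = (\<Sum>i\<in>UNIV. \<Sum>j\<in>UNIV. (w i j * g i) * f j)"
      unfolding eigen[symmetric] sum_distrib_left by (simp add: mult_ac)
    also have "\<dots> \<le> C"
      unfolding C_def
      by (intro sum_mono mult_left_mono mult_nonneg_nonneg weight_nonneg g_nonneg) (simp add: g_def)
    finally have "(\<mu> * A)\<^sup>2 \<le> C\<^sup>2"
      using that \<open>A > 0\<close> by (intro power_mono) auto
    also note key
    finally show ?thesis using \<open>A > 0\<close> by (simp add: power_mult_distrib)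
  qed
  ultimately show ?thesis by blast
qed

text \<open>Orthogonality to the constants forces \<open>f\<close> to take both signs. The
  positivity sets of \<open>f\<close> and of its negative are disjoint, so one of them has at most
  half of the volume, and the eigenvector equation survives the sign change.\<close>

lemma cheeger_inequality:
  assumes eigen: "\<And>i. (\<Sum>j\<in>UNIV. w i j * f j) = \<mu> * degree w i * f i"
    and orth: "(\<Sum>i\<in>UNIV. degree w i * f i) = 0" and nz: "f k \<noteq> 0"
  shows "(cheeger w)\<^sup>2 \<le> 1" and "0 \<le> \<mu> \<Longrightarrow> \<mu>\<^sup>2 \<le> 1 - (cheeger w)\<^sup>2"
proof -
  \<comment> \<open>Without a positive value all terms of the sum have the same sign, so each is 0,
    against \<open>g k \<noteq> 0\<close>.\<close>
  have ex_pos: "\<exists>p. g p > 0"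
    if "(\<Sum>i\<in>UNIV. degree w i * g i) = 0" "g k \<noteq> 0" for g
  proof (rule ccontr)
    assume "\<nexists>p. g p > 0"
    then have "0 \<le> degree w i * (- g i)" for i
      using degree_pos by (intro mult_nonneg_nonneg less_imp_le[OF degree_pos]) (simp add: not_less)
    moreover have "(\<Sum>i\<in>UNIV. degree w i * (- g i)) = 0"
      using that(1) by (simp add: sum_negf)
    ultimately have "degree w k * (- g k) = 0"
      by (subst (asm) sum_nonneg_eq_0_iff) auto
    with that(2) degree_pos[of k] show False by simp
  qed
  consider "(\<Sum>i | f i > 0. degree w i) \<le> (\<Sum>i\<in>-{i. f i > 0}. degree w i)"
    | "(\<Sum>i | - f i > 0. degree w i) \<le> (\<Sum>i\<in>-{i. - f i > 0}. degree w i)"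
  proof (rule linorder_le_cases)
    show "(\<Sum>i\<in>-{i. f i > 0}. degree w i) \<le> (\<Sum>i | f i > 0. degree w i) \<Longrightarrow> thesis"
    proof (rule that(2))
      assume *: "(\<Sum>i\<in>-{i. f i > 0}. degree w i) \<le> (\<Sum>i | f i > 0. degree w i)"
      have "(\<Sum>i | - f i > 0. degree w i) \<le> (\<Sum>i\<in>-{i. f i > 0}. degree w i)"
        by (intro sum_mono2 less_imp_le[OF degree_pos]) auto
      also note *
      also have "(\<Sum>i | f i > 0. degree w i) \<le> (\<Sum>i\<in>-{i. - f i > 0}. degree w i)"
        by (intro sum_mono2 less_imp_le[OF degree_pos]) auto
      finally show "(\<Sum>i | - f i > 0. degree w i) \<le> (\<Sum>i\<in>-{i. - f i > 0}. degree w i)" .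
    qed
  qed (rule that(1))
  then have "(cheeger w)\<^sup>2 \<le> 1 \<and> (0 \<le> \<mu> \<longrightarrow> \<mu>\<^sup>2 \<le> 1 - (cheeger w)\<^sup>2)"
  proof cases
    case 1
    then show ?thesis using ex_pos[of f] eigen orth nz cheeger_inequality_half by blast
  next
    case 2
    have "(\<Sum>j\<in>UNIV. w i j * (- f j)) = \<mu> * degree w i * (- f i)" for i
      using eigen[of i] by (simp add: sum_negf)
    moreover obtain p where "- f p > 0"
      using ex_pos[of "\<lambda>i. - f i"] orth nz by (auto simp: sum_negf)
    ultimately show ?thesis using cheeger_inequality_half[of "\<lambda>i. - f i" \<mu> p] 2 by blast
  qed
  then show "(cheeger w)\<^sup>2 \<le> 1" and "0 \<le> \<mu> \<Longrightarrow> \<mu>\<^sup>2 \<le> 1 - (cheeger w)\<^sup>2" by blast+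
qed

end

subsection \<open>Neighborhood graphs\<close>

lemma nbhd_weight_1: "nbhd_weight w (Suc 0) i j = w i j"
  by (simp add: nbhd_weight_def)

text \<open>A walk is split after its first step, to the vertex \<open>k\<close> that heads the
  tuple. Indices start at 1 because length 0 is meaningless, hence the two successors.\<close>

lemma nbhd_weight_Suc:
  "nbhd_weight w (Suc (Suc n)) i j = (\<Sum>k\<in>UNIV. w i k / degree w k * nbhd_weight w (Suc n) k j)"
proof -
  let ?P = "\<lambda>i ks n. \<Prod>m<n. w ((i # ks @ [j]) ! m) ((i # ks @ [j]) ! Suc m)"
  have lists: "{ks. length ks = Suc n} = (\<lambda>(k, ks). k # ks) ` (UNIV \<times> {ks. length ks = n})"
    by (auto simp: length_Suc_conv)
  have "nbhd_weight w (Suc (Suc n)) i j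
      = (\<Sum>(k, ks)\<in>UNIV \<times> {ks. length ks = n}.
           (\<Prod>k\<leftarrow>k # ks. 1 / degree w k) * ?P i (k # ks) (Suc (Suc n)))"
    unfolding nbhd_weight_def diff_Suc_1 lists
    by (subst sum.reindex) (auto simp: inj_on_def case_prod_unfold)
  also have "\<dots> = (\<Sum>k\<in>UNIV. \<Sum>ks | length ks = n.
      w i k / degree w k * ((\<Prod>k\<leftarrow>ks. 1 / degree w k) * ?P k ks (Suc n)))"
    unfolding sum.cartesian_product[symmetric]
    by (intro sum.cong refl, subst prod.lessThan_Suc_shift) (simp add: mult_ac)
  finally show ?thesis
    by (simp add: nbhd_weight_def sum_distrib_left)
qed

text \<open>Splitting off the last step instead; the two recursions together yield symmetry by
  reversal of walks.\<close>

lemma nbhd_weight_Suc_right: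
  "nbhd_weight w (Suc (Suc n)) i j = (\<Sum>k\<in>UNIV. nbhd_weight w (Suc n) i k / degree w k * w k j)"
proof (induction n arbitrary: i)
  case 0
  show ?case by (simp add: nbhd_weight_Suc nbhd_weight_1)
next
  case (Suc n)
  have "nbhd_weight w (Suc (Suc (Suc n))) i j
      = (\<Sum>k\<in>UNIV. \<Sum>m\<in>UNIV. w i k / degree w k * nbhd_weight w (Suc n) k m / degree w m * w m j)"
    by (subst nbhd_weight_Suc) (simp add: Suc sum_distrib_left mult_ac)
  also have "\<dots> = (\<Sum>m\<in>UNIV. nbhd_weight w (Suc (Suc n)) i m / degree w m * w m j)"
    by (subst sum.swap) (simp add: nbhd_weight_Suc[of _ n] sum_distrib_right sum_divide_distrib)
  finally show ?case .
qed

context weight_function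
begin

text \<open>Reversing a walk turns the first-step recursion for \<open>i\<close>, \<open>j\<close>
  into the last-step recursion for \<open>j\<close>, \<open>i\<close>.\<close>

lemma nbhd_weight_sym: "nbhd_weight w (Suc n) i j = nbhd_weight w (Suc n) j i"
proof (induction n arbitrary: i j)
  case 0
  show ?case by (simp add: nbhd_weight_1 weight_sym)
next
  case (Suc n)
  have "nbhd_weight w (Suc (Suc n)) i j = (\<Sum>k\<in>UNIV. w i k / degree w k * nbhd_weight w (Suc n) k j)"
    by (rule nbhd_weight_Suc)
  also have "\<dots> = (\<Sum>k\<in>UNIV. nbhd_weight w (Suc n) j k / degree w k * w k i)"
    by (intro sum.cong refl) (simp add: Suc[of _ j] weight_sym[of i])
  also have "\<dots> = nbhd_weight w (Suc (Suc n)) j i"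
    by (rule nbhd_weight_Suc_right[symmetric])
  finally show ?case .
qed

lemma nbhd_weight_nonneg: "0 \<le> nbhd_weight w (Suc n) i j"
proof (induction n arbitrary: i j)
  case 0
  show ?case by (simp add: nbhd_weight_1 weight_nonneg)
next
  case (Suc n)
  show ?case
    unfolding nbhd_weight_Suc[of _ n]
    by (intro sum_nonneg mult_nonneg_nonneg divide_nonneg_pos weight_nonneg degree_pos Suc)
qed

text \<open>In the first-step recursion the division by \<open>degree w k\<close> cancels the degree
  from the induction hypothesis, which leaves one more application of \<open>w\<close> to
  \<open>v\<close>.\<close>

lemma nbhd_weight_eigen:
  assumes "\<And>i. (\<Sum>j\<in>UNIV. w i j * v j) = \<rho> * degree w i * v i"
  shows "(\<Sum>j\<in>UNIV. nbhd_weight w (Suc n) i j * v j) = \<rho> ^ Suc n * degree w i * v i"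
proof (induction n arbitrary: i)
  case 0
  show ?case by (simp add: nbhd_weight_1 assms)
next
  case (Suc n)
  have "(\<Sum>j\<in>UNIV. nbhd_weight w (Suc (Suc n)) i j * v j)
      = (\<Sum>k\<in>UNIV. w i k / degree w k * (\<Sum>j\<in>UNIV. nbhd_weight w (Suc n) k j * v j))"
    unfolding nbhd_weight_Suc sum_distrib_right sum_distrib_left
    by (subst sum.swap) (simp add: mult_ac)
  also have "\<dots> = \<rho> ^ Suc n * (\<Sum>k\<in>UNIV. w i k * v k)"
    unfolding Suc sum_distrib_left using degree_pos
    by (intro sum.cong refl) (simp add: field_simps less_imp_neq[symmetric])
  finally show ?case by (simp add: assms)
qed

text \<open>The constant function 1 satisfies the eigenvector equation with
  \<open>\<rho> = 1\<close>, and the left side then is the row sum.\<close>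

lemma degree_nbhd_weight: "degree (nbhd_weight w (Suc n)) i = degree w i"
  using nbhd_weight_eigen[of "\<lambda>_. 1" 1 n i] by (simp add: degree_def)

lemma weight_function_nbhd_weight: "weight_function (nbhd_weight w (Suc n))"
  by unfold_locales (simp_all add: nbhd_weight_sym nbhd_weight_nonneg degree_nbhd_weight degree_pos)

subsection \<open>The normalized Laplacian\<close>

lemma laplacian_nth: "laplacian w v $ i = v $ i - (\<Sum>j\<in>UNIV. w i j * v $ j) / degree w i"
proof -
  have "(\<Sum>j\<in>UNIV. w i j * (v $ i - v $ j)) = degree w i * v $ i - (\<Sum>j\<in>UNIV. w i j * v $ j)"
    by (simp add: degree_def sum_distrib_right right_diff_distrib sum_subtractf)
  then show ?thesis
    using degree_pos[of i] by (simp add: laplacian_def diff_divide_distrib)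
qed

lemma laplacian_eigenvectorD:
  assumes "laplacian w v = \<mu> *\<^sub>R v"
  shows "(\<Sum>j\<in>UNIV. w i j * v $ j) = (1 - \<mu>) * degree w i * v $ i"
proof -
  have "laplacian w v $ i = \<mu> * v $ i" using assms by simp
  then show ?thesis
    using degree_pos[of i] by (simp add: laplacian_nth field_simps)
qed

lemma linear_laplacian: "linear (laplacian w)"
proof (rule linearI)
  show "laplacian w (x + y) = laplacian w x + laplacian w y" for x y
    by (simp add: vec_eq_iff laplacian_nth distrib_left sum.distrib add_divide_distrib)
  show "laplacian w (c *\<^sub>R x) = c *\<^sub>R laplacian w x" for c x
    by (simp add: vec_eq_iff laplacian_nth right_diff_distrib sum_distrib_left mult.left_commute)
qed

text \<open>Conjugation by the square root of the degrees turns the Laplacian into a self-adjoint map.\<close>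

lemma laplacian_eigenbasis:
  obtains B m where "independent B" "span B = UNIV" "\<And>b. b \<in> B \<Longrightarrow> laplacian w b = m b *\<^sub>R b"
proof -
  \<comment> \<open>\<open>s\<close> is multiplication by the square root of the degree matrix and
    \<open>s'\<close> its inverse.\<close>
  define s :: "real ^ 'v \<Rightarrow> real ^ 'v" where "s v = (\<chi> i. sqrt (degree w i) * v $ i)" for v
  define s' :: "real ^ 'v \<Rightarrow> real ^ 'v" where "s' v = (\<chi> i. v $ i / sqrt (degree w i))" for v
  define g where "g = (\<lambda>v. s (laplacian w (s' v)))"
  have inverse: "s (s' v) = v" "s' (s v) = v" for v
    using degree_pos by (simp_all add: s_def s'_def vec_eq_iff less_imp_neq[symmetric])
  have lin: "linear s" "linear s'"
    unfolding s_def s'_def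
    by (auto intro!: linearI simp: vec_eq_iff algebra_simps add_divide_distrib)
  have "linear g"
    unfolding g_def using linear_compose[OF linear_compose[OF lin(2) linear_laplacian] lin(1)]
    by (simp add: o_def)
  moreover have "g x \<bullet> y = x \<bullet> g y" for x y
  proof -
    \<comment> \<open>The off-diagonal part of \<open>g\<close> has the kernel \<open>w i j\<close>
      divided by both square roots, which is symmetric in \<open>i\<close> and
      \<open>j\<close>.\<close>
    have gi: "g x $ i = x $ i - (\<Sum>j\<in>UNIV. w i j / (sqrt (degree w i) * sqrt (degree w j)) * x $ j)" for x i
    proof -
      have "g x $ i = sqrt (degree w i) * (x $ i / sqrt (degree w i))
          - sqrt (degree w i) / degree w i * (\<Sum>j\<in>UNIV. w i j * (x $ j / sqrt (degree w j)))"
        by (simp add: g_def s_def s'_def laplacian_nth algebra_simps)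
      also have "sqrt (degree w i) / degree w i = 1 / sqrt (degree w i)"
        using degree_pos[of i] by (simp add: real_div_sqrt field_simps)
      finally show ?thesis
        using degree_pos[of i] by (simp add: sum_distrib_left field_simps)
    qed
    have "(\<Sum>i\<in>UNIV. \<Sum>j\<in>UNIV. w i j / (sqrt (degree w i) * sqrt (degree w j)) * x $ j * y $ i)
        = (\<Sum>i\<in>UNIV. \<Sum>j\<in>UNIV. w i j / (sqrt (degree w i) * sqrt (degree w j)) * x $ i * y $ j)"
      by (subst sum.swap) (simp add: weight_sym mult_ac)
    then show ?thesis
      by (simp add: inner_vec_def gi left_diff_distrib right_diff_distrib sum_subtractf
          sum_distrib_left sum_distrib_right mult_ac)
  qed
  ultimately obtain B m where B: "independent B" "span B = UNIV" "\<And>b. b \<in> B \<Longrightarrow> g b = m b *\<^sub>R b"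
    using self_adjoint_eigenbasis by blast
  have "inj s'" by (rule inj_on_inverseI) (rule inverse)
  have "independent (s' ` B)"
    using B(1) lin(2) \<open>inj s'\<close> by (metis B(2) linear_independent_injective_image)
  moreover have "span (s' ` B) = UNIV"
    using linear_span_image[OF lin(2)] B(2) inverse(2) by (metis surjI)
  \<comment> \<open>The basis is pulled back along \<open>s'\<close>, so the eigenvalue of
    \<open>b\<close> is read off at its preimage \<open>s b\<close>.\<close>
  moreover have "laplacian w b = m (s b) *\<^sub>R b" if b: "b \<in> s' ` B" for b
  proof -
    obtain c where c: "c \<in> B" "b = s' c" using b by auto
    have "laplacian w b = s' (g c)" by (simp add: g_def inverse c)
    also have "\<dots> = m (s b) *\<^sub>R b"
      using c B(3) by (simp add: inverse linear_scale[OF lin(2)])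
    finally show ?thesis .
  qed
  ultimately show thesis by (rule that)
qed

text \<open>Green's formula for an eigenvector; it gives nonnegativity of the spectrum and, at
  \<open>\<mu> = 0\<close>, the kernel.\<close>

lemma laplacian_eigenvector_sum_sq_diff:
  assumes "laplacian w v = \<mu> *\<^sub>R v"
  shows "(\<Sum>i\<in>UNIV. \<Sum>j\<in>UNIV. w i j * (v $ i - v $ j)\<^sup>2)
    = 2 * \<mu> * (\<Sum>i\<in>UNIV. degree w i * (v $ i)\<^sup>2)"
proof -
  have "(\<Sum>i\<in>UNIV. \<Sum>j\<in>UNIV. w i j * v $ i * v $ j) = (\<Sum>i\<in>UNIV. v $ i * (\<Sum>j\<in>UNIV. w i j * v $ j))"
    by (simp add: sum_distrib_left mult_ac)
  also have "\<dots> = (1 - \<mu>) * (\<Sum>i\<in>UNIV. degree w i * (v $ i)\<^sup>2)"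
    unfolding laplacian_eigenvectorD[OF assms]
    by (simp add: sum_distrib_left power2_eq_square mult_ac)
  finally show ?thesis
    by (simp add: sum_weight_sq_diff algebra_simps)
qed

section \<open>Bounds for the eigenvalues of the Laplacian\<close>

lemma laplacian_eigenvalue_nonneg:
  assumes "eigenvalue (laplacian w) \<mu>"
  shows "0 \<le> \<mu>"
proof -
  obtain v where v: "v \<noteq> 0" "laplacian w v = \<mu> *\<^sub>R v"
    using assms by (auto simp: eigenvalue_def)
  then obtain k where "v $ k \<noteq> 0" by (auto simp: vec_eq_iff)
  then have "0 < (\<Sum>i\<in>UNIV. degree w i * (v $ i)\<^sup>2)"
    using degree_pos by (intro sum_pos2[of _ k] mult_nonneg_nonneg less_imp_le[OF degree_pos]) auto
  moreover have "0 \<le> (\<Sum>i\<in>UNIV. \<Sum>j\<in>UNIV. w i j * (v $ i - v $ j)\<^sup>2)"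
    by (intro sum_nonneg mult_nonneg_nonneg weight_nonneg) auto
  ultimately show ?thesis
    unfolding laplacian_eigenvector_sum_sq_diff[OF v(2)] by (simp add: zero_le_mult_iff)
qed

text \<open>Summing the eigenvector equation over all vertices and swapping the sums shows that the
  weighted total is \<open>1 - \<mu>\<close> times itself.\<close>

lemma laplacian_eigenvector_orthogonal:
  assumes "laplacian w v = \<mu> *\<^sub>R v" "\<mu> \<noteq> 0"
  shows "(\<Sum>i\<in>UNIV. degree w i * v $ i) = 0"
proof -
  have "(1 - \<mu>) * (\<Sum>i\<in>UNIV. degree w i * v $ i) = (\<Sum>i\<in>UNIV. \<Sum>j\<in>UNIV. w i j * v $ j)"
    unfolding laplacian_eigenvectorD[OF assms(1)] by (simp add: sum_distrib_left mult_ac)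
  also have "\<dots> = (\<Sum>i\<in>UNIV. degree w i * v $ i)"
    by (subst sum.swap) (simp add: degree_def sum_distrib_right weight_sym)
  finally show ?thesis using assms(2) by (simp add: algebra_simps)
qed

text \<open>Cheeger's inequality in the neighborhood graph. The sign premise is met when the
  exponent is even or \<open>\<mu> \<le> 1\<close>, which is where the parity of \<open>l\<close>
  enters.\<close>

lemma laplacian_eigenvalue_cheeger:
  fixes n :: nat
  assumes "eigenvalue (laplacian w) \<mu>" "\<mu> \<noteq> 0"
  defines "h \<equiv> cheeger (nbhd_weight w (Suc n))"
  shows "h\<^sup>2 \<le> 1" and "0 \<le> (1 - \<mu>) ^ Suc n \<Longrightarrow> ((1 - \<mu>) ^ Suc n)\<^sup>2 \<le> 1 - h\<^sup>2"
proof -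
  obtain v where v: "v \<noteq> 0" "laplacian w v = \<mu> *\<^sub>R v"
    using assms by (auto simp: eigenvalue_def)
  then obtain k where k: "v $ k \<noteq> 0" by (auto simp: vec_eq_iff)
  interpret nbhd: weight_function "nbhd_weight w (Suc n)"
    by (rule weight_function_nbhd_weight)
  have eigen: "(\<Sum>j\<in>UNIV. nbhd_weight w (Suc n) i j * v $ j)
      = (1 - \<mu>) ^ Suc n * degree (nbhd_weight w (Suc n)) i * v $ i" for i
    unfolding degree_nbhd_weight by (rule nbhd_weight_eigen[OF laplacian_eigenvectorD[OF v(2)]])
  have orth: "(\<Sum>i\<in>UNIV. degree (nbhd_weight w (Suc n)) i * v $ i) = 0"
    unfolding degree_nbhd_weight by (rule laplacian_eigenvector_orthogonal[OF v(2) assms(2)])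
  show "h\<^sup>2 \<le> 1" and "0 \<le> (1 - \<mu>) ^ Suc n \<Longrightarrow> ((1 - \<mu>) ^ Suc n)\<^sup>2 \<le> 1 - h\<^sup>2"
    unfolding h_def using nbhd.cheeger_inequality[OF eigen orth k] by blast+
qed

lemma
  assumes "eigenvalue (laplacian w) \<mu>" "\<mu> \<noteq> 0" "1 \<le> l"
  defines "r \<equiv> root (2 * l) (1 - (cheeger (nbhd_weight w l))\<^sup>2)"
  shows laplacian_eigenvalue_ge: "1 - r \<le> \<mu>"
    and laplacian_eigenvalue_le: "even l \<Longrightarrow> \<mu> \<le> 1 + r"
proof -
  obtain n where l: "l = Suc n" using assms(3) by (cases l) auto
  have "0 \<le> r"
    unfolding r_def l using laplacian_eigenvalue_cheeger(1)[OF assms(1,2), of n] by simp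
  \<comment> \<open>Taking the root of order \<open>2 * l\<close> gives a two-sided bound on
    \<open>1 - \<mu>\<close>.\<close>
  have abs_le: "\<bar>1 - \<mu>\<bar> \<le> r" if "0 \<le> (1 - \<mu>) ^ l"
  proof -
    have "\<bar>1 - \<mu>\<bar> ^ (2 * l) = ((1 - \<mu>) ^ l)\<^sup>2"
      by (simp add: power_even_abs flip: power_mult) (simp add: mult.commute)
    also have "\<dots> \<le> 1 - (cheeger (nbhd_weight w l))\<^sup>2"
      using laplacian_eigenvalue_cheeger(2)[OF assms(1,2), of n] that unfolding l by blast
    finally have "root (2 * l) (\<bar>1 - \<mu>\<bar> ^ (2 * l)) \<le> r"
      unfolding r_def using assms(3) by (subst real_root_le_iff) auto
    then show ?thesis using assms(3) by (simp add: real_root_power_cancel)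
  qed
  show "1 - r \<le> \<mu>"
  proof (cases "0 \<le> 1 - \<mu>")
    case True
    then show ?thesis using abs_le zero_le_power[of "1 - \<mu>" l] by linarith
  \<comment> \<open>For \<open>\<mu> > 1\<close> the power may be negative, but the lower bound is
    immediate from \<open>0 \<le> r\<close>.\<close>
  next
    case False
    then show ?thesis using \<open>0 \<le> r\<close> by linarith
  qed
  show "\<mu> \<le> 1 + r" if "even l"
    using abs_le[OF zero_le_even_power[OF that]] by linarith
qed

end

section \<open>Consequences of connectedness\<close>

lemma weight_function_connected:
  fixes w :: "'v::finite \<Rightarrow> 'v \<Rightarrow> real"
  assumes "weighted_graph E w" "connected_graph E" "CARD('v) \<ge> 2"
  shows "weight_function w"
proof
  show sym: "w i j = w j i" for i j
    using assms(1) by (auto simp: weighted_graph_def)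
  show nonneg: "0 \<le> w i j" for i j
    using assms(1) by (cases "(i, j) \<in> E") (auto simp: weighted_graph_def less_imp_le)
  show "0 < degree w i" for i
  proof -
    have "UNIV \<noteq> {i}" using assms(3) by (metis card.empty card.insert empty_iff finite.emptyI
          not_less_eq_eq numeral_2_eq_2 le_refl)
    then obtain j where "j \<noteq> i" by blast
    moreover have "(i, j) \<in> E\<^sup>*" using assms(2) by (simp add: connected_graph_def)
    \<comment> \<open>The first edge of a path to another vertex is incident to \<open>i\<close> and
      makes its degree positive.\<close>
    ultimately obtain k where "(i, k) \<in> E" by (metis converse_rtranclE)
    then have "w i k > 0" using assms(1) by (simp add: weighted_graph_def)
    then show ?thesis
      unfolding degree_def using nonneg by (intro sum_pos2[of _ k]) auto
  qed
qed

text \<open>A kernel vector has zero energy, so it agrees at the ends of every edge and is constant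
  along paths.\<close>

lemma dim_laplacian_kernel:
  fixes w :: "'v::finite \<Rightarrow> 'v \<Rightarrow> real"
  assumes "weighted_graph E w" "connected_graph E" "CARD('v) \<ge> 2"
  shows "dim (eigenspace (laplacian w) 0) = 1"
proof -
  interpret weight_function w using assms by (rule weight_function_connected)
  have "eigenspace (laplacian w) 0 = span {vec 1}"
  proof (intro equalityI subsetI)
    fix v assume "v \<in> eigenspace (laplacian w) 0"
    then have v: "laplacian w v = 0 *\<^sub>R v" by (simp add: eigenspace_def)
    have nn: "0 \<le> w i j * (v $ i - v $ j)\<^sup>2" for i j
      using weight_nonneg by simp
    have "(\<Sum>i\<in>UNIV. \<Sum>j\<in>UNIV. w i j * (v $ i - v $ j)\<^sup>2) = 0"
      unfolding laplacian_eigenvector_sum_sq_diff[OF v] by simp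
    then have zero: "w i j * (v $ i - v $ j)\<^sup>2 = 0" for i j
      using nn by (simp add: sum_nonneg_eq_0_iff sum_nonneg)
    have edge: "v $ i = v $ j" if "(i, j) \<in> E" for i j
      using zero[of i j] that assms(1) by (force simp: weighted_graph_def)
    have "v $ i = v $ j" for i j
    proof -
      have "(i, j) \<in> E\<^sup>*" using assms(2) by (simp add: connected_graph_def)
      then show ?thesis by induction (auto dest: edge)
    qed
    \<comment> \<open>\<open>undefined\<close> serves as an arbitrary base vertex; \<open>v\<close>
      is constant.\<close>
    then have "v = (v $ undefined) *\<^sub>R vec 1" by (auto simp: vec_eq_iff)
    then show "v \<in> span {vec 1}" by (metis span_base span_scale singletonI)
  next
    fix v :: "real ^ 'v" assume "v \<in> span {vec 1}"
    then obtain c where "v = c *\<^sub>R vec 1" by (auto simp: span_singleton)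
    then show "v \<in> eigenspace (laplacian w) 0"
      by (simp add: eigenspace_def laplacian_def vec_eq_iff)
  qed
  moreover have "independent {vec 1 :: real ^ 'v}" by (simp add: vec_eq_iff)
  ultimately show ?thesis by (simp add: dim_span_eq_card_independent)
qed

section \<open>The position of 0 in the sorted spectrum, and the conclusion\<close>

lemma count_list_ge_2:
  assumes "i < j" "j < length xs" "xs ! i = x" "xs ! j = x"
  shows "count_list xs x \<ge> 2"
proof -
  have "card {i, j} \<le> card {k. k < length xs \<and> x = xs ! k}"
    using assms by (intro card_mono) auto
  then show ?thesis
    using assms by (simp add: count_list_eq_length_filter length_filter_conv_card)
qed

theorem corollary5p1:
  fixes E :: "('v::finite \<times> 'v) set" and w :: "'v \<Rightarrow> 'v \<Rightarrow> real" and l :: nat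
  assumes "weighted_graph E w"
    and "connected_graph E"
    and "CARD('v) \<ge> 2"
    and "l \<ge> 1"
  shows "let N = CARD('v);
             ev = sorted_eigenvalues (laplacian w);
             h = cheeger (nbhd_weight w l);
             r = root (2 * l) (1 - h\<^sup>2)
         in length ev = N \<and> sorted ev \<and> ev ! 0 = 0 \<and> 0 < ev ! 1 \<and>
            (even l \<longrightarrow> 1 - r \<le> ev ! 1 \<and> ev ! (N - 1) \<le> 1 + r) \<and>
            (odd l \<longrightarrow> 1 - r \<le> ev ! 1)"
proof -
  interpret weight_function w using assms(1-3) by (rule weight_function_connected)
  let ?L = "laplacian w"
  define ev where "ev = sorted_eigenvalues ?L"
  obtain B m where "independent B" "span B = UNIV" "\<And>b. b \<in> B \<Longrightarrow> ?L b = m b *\<^sub>R b"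
    using laplacian_eigenbasis by blast
  note basis = linear_laplacian this
  have fin: "finite {\<mu>. eigenvalue ?L \<mu>}"
    by (rule finite_eigenvalues_eigenbasis[OF basis])
  have len: "length ev = CARD('v)"
    unfolding ev_def length_sorted_eigenvalues[OF fin] by (rule sum_dim_eigenspaces_eigenbasis[OF basis])
  have "sorted ev" by (simp add: ev_def sorted_eigenvalues_def)
  have eigen: "eigenvalue ?L \<mu>" if "\<mu> \<in> set ev" for \<mu>
    using that set_sorted_eigenvalues[OF fin] by (auto simp: ev_def)
  have "eigenvalue ?L 0"
  proof -
    have "?L (vec 1) = 0 *\<^sub>R vec 1" by (simp add: laplacian_def vec_eq_iff)
    moreover have "vec 1 \<noteq> (0 :: real ^ 'v)" by (simp add: vec_eq_iff)
    ultimately show ?thesis unfolding eigenvalue_def by blast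
  qed
  then have count0: "count_list ev 0 = 1"
    unfolding ev_def count_sorted_eigenvalues[OF fin \<open>eigenvalue ?L 0\<close>]
    using dim_laplacian_kernel[OF assms(1-3)] by simp
  have nonneg: "0 \<le> ev ! i" if "i < CARD('v)" for i
    using that len eigen laplacian_eigenvalue_nonneg by simp
  have "0 \<in> set ev" using count0 by (metis count_list_0_iff zero_neq_one)
  then obtain i where i: "i < CARD('v)" "ev ! i = 0" using len by (metis in_set_conv_nth)
  \<comment> \<open>The eigenvalue 0 occurs somewhere and no entry is negative, so sortedness puts
    it first.\<close>
  have "ev ! 0 \<le> ev ! i" using \<open>sorted ev\<close> i len by (intro sorted_nth_mono) auto
  then have ev0: "ev ! 0 = 0" using i nonneg[of 0] by simp
  \<comment> \<open>A second zero entry would contradict the simplicity of the eigenvalue 0.\<close>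
  have "ev ! 1 \<noteq> 0"
    using count_list_ge_2[of 0 1 ev 0] ev0 count0 len assms(3) by auto
  then have ev1: "0 < ev ! 1" using nonneg[of 1] assms(3) by simp
  \<comment> \<open>The last entry must be shown to be nonzero as well before the upper bound
    applies to it.\<close>
  have "ev ! 1 \<le> ev ! (CARD('v) - 1)"
    using \<open>sorted ev\<close> len assms(3) by (intro sorted_nth_mono) auto
  with ev1 have evN: "0 < ev ! (CARD('v) - 1)" by linarith
  have "eigenvalue ?L (ev ! 1)" "eigenvalue ?L (ev ! (CARD('v) - 1))"
    using eigen len assms(3) by simp_all
  then show ?thesis
    using len \<open>sorted ev\<close> ev0 ev1 evN laplacian_eigenvalue_ge[OF _ _ assms(4)]
      laplacian_eigenvalue_le[OF _ _ assms(4)]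
    unfolding Let_def ev_def[symmetric] by auto
qed

end
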